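(* Assume that all compact Hausdorff spaces with small diagonal are metrizable. Let $X$ be a nonseparable real Banach space. Then $\mathfrak{cov}(X)=\omega_1$.
   Context: For a compact Hausdorff space $K$ let $\Delta(K)=\{(x,x):x\in K\}\subseteq K^2$. $K$ has small diagonal if for every uncountable $A\subseteq K^2\setminus\Delta(K)$ there is an uncountable $B\subseteq A$ whose closure is disjoint from $\Delta(K)$. A hyperplane of a Banach space $X$ is a one-codimensional closed linear subspace of $X$. $\mathcal{H}_\sigma(X)$ is the family of all subsets of $X$ that can be covered by countably many hyperplanes of $X$, and $\mathfrak{cov}(X)$ is the minimal cardinality of a family of sets from $\mathcal{H}_\sigma(X)$ whose union is $X$. *)

theory Defs
  imports "HOL-Analysis.Analysis"
begin

unbundle cardinal_syntax

definition diagonal :: "'k topology \<Rightarrow> ('k \<times> 'k) set"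
  where "diagonal K = {(x, x) | x. x \<in> topspace K}"

definition has_small_diagonal :: "'k topology \<Rightarrow> bool"
  where "has_small_diagonal K \<longleftrightarrow>
    (\<forall>A. A \<subseteq> topspace K \<times> topspace K - diagonal K \<and> uncountable A \<longrightarrow>
      (\<exists>B. B \<subseteq> A \<and> uncountable B \<and>
        (prod_topology K K closure_of B) \<inter> diagonal K = {}))"

(* Codimension one: H is proper, and adding one vector to it spans the whole space. *)
definition is_hyperplane :: "'a::real_normed_vector set \<Rightarrow> bool"
  where "is_hyperplane H \<longleftrightarrow>
    closed H \<and> subspace H \<and> (\<exists>x. x \<notin> H \<and> span (insert x H) = UNIV)"

definition H_sigma :: "'a::real_normed_vector set set"
  where "H_sigma =
    {A. \<exists>\<H>. countable \<H> \<and> (\<forall>H\<in>\<H>. is_hyperplane H) \<and> A \<subseteq> \<Union>\<H>}"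

definition covers_by_H_sigma :: "'a::real_normed_vector set set \<Rightarrow> bool"
  where "covers_by_H_sigma \<F> \<longleftrightarrow> \<F> \<subseteq> H_sigma \<and> \<Union>\<F> = UNIV"

(* The cardinality of a covering family of least cardinality. Such a family exists whenever
   there is any covering family, in particular in every space of dimension at least 2;
   otherwise the value is unspecified. Cardinals are compared by =o and \<le>o. *)
definition cov :: "'a::real_normed_vector itself \<Rightarrow> 'a set rel"
  where "cov _ =
    |SOME \<F> :: 'a set set. covers_by_H_sigma \<F> \<and>
       (\<forall>\<G> :: 'a set set. covers_by_H_sigma \<G> \<longrightarrow> |\<F>| \<le>o |\<G>| )|"

abbreviation omega_1 :: "nat set rel"
  where "omega_1 \<equiv> cardSuc natLeq"

end

theory Submission
  imports Defs "HOL-Library.Countable_Set_Type"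
begin

text \<open>
  The unit ball \<open>K\<close> of the dual of \<open>X\<close>, with the weak-star topology, is a compact Hausdorff
  space. If it were metrizable, the functional \<open>0\<close> would have a countable neighbourhood base. A
  weak-star neighbourhood of \<open>0\<close> contains every functional of \<open>K\<close> that vanishes on a suitable finite
  set, so only \<open>0\<close> would vanish on some countable set, and by Hahn and Banach the closed
  linear span of that set would be \<open>X\<close>. Hence for nonseparable \<open>X\<close> the ball is not metrizable, and
  by assumption it does not have small diagonal: there is an uncountable set \<open>A\<close> of pairs of
  distinct functionals, every uncountable subset of which accumulates at the diagonal.
  
  Such an \<open>A\<close> yields a cover of \<open>X\<close>. For fixed \<open>x\<close> and \<open>n\<close>, the pairs \<open>(f, g)\<close> with
  \<open>\<bar>f x - g x\<bar> \<ge> 1 / (n + 1)\<close> lie in a closed set missing the diagonal, so only countably many of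
  them belong to \<open>A\<close>. Taking the union over \<open>n\<close>, all but countably many \<open>(f, g) \<in> A\<close> satisfy
  \<open>f x = g x\<close>. Since \<open>A\<close> may be shrunk to cardinality \<open>\<omega>\<^sub>1\<close>, the kernels of the differences
  \<open>f - g\<close> form a family of at most \<open>\<omega>\<^sub>1\<close> hyperplanes covering \<open>X\<close>. Conversely, a countable
  covering family of sets in \<open>H_sigma\<close> would exhibit \<open>X\<close> as a countable union of nowhere dense
  hyperplanes, against the Baire category theorem.
  
  The upper bound is carried by \<open>first_countable_dual_ball_imp_separable\<close> and
  \<open>countable_separated_pairs\<close>, the lower bound by \<open>uncountable_covers_by_H_sigma\<close>.
\<close>

section \<open>Linear functionals below a sublinear functional\<close>

definition sublinear :: "('a::real_vector \<Rightarrow> real) \<Rightarrow> bool"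
  where "sublinear q \<longleftrightarrow>
    (\<forall>x y. q (x + y) \<le> q x + q y) \<and> (\<forall>c x. 0 \<le> c \<longrightarrow> q (c *\<^sub>R x) = c * q x)"

lemma sublinear_add: "sublinear q \<Longrightarrow> q (x + y) \<le> q x + q y"
  by (simp add: sublinear_def)

lemma sublinear_scaleR: "sublinear q \<Longrightarrow> 0 \<le> c \<Longrightarrow> q (c *\<^sub>R x) = c * q x"
  by (simp add: sublinear_def)

lemma sublinear_zero: "sublinear q \<Longrightarrow> q 0 = 0"
  using sublinear_scaleR[of q 0 0] by simp

lemma sublinear_minus: "sublinear q \<Longrightarrow> - q (- x) \<le> q x"
  using sublinear_add[of q x "- x"] sublinear_zero[of q] by simp

lemma sublinearI:
  assumes add: "\<And>x y. q (x + y) \<le> q x + q y"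
    and scale: "\<And>c x. 0 < c \<Longrightarrow> q (c *\<^sub>R x) \<le> c * q x"
  shows "sublinear q"
proof -
  have zero: "q 0 = 0"
    using scale[of "1/2" 0] scale[of 2 0] by simp
  have "q (c *\<^sub>R x) = c * q x" if "0 < c" for c x
  proof (rule antisym)
    have "q x \<le> inverse c * q (c *\<^sub>R x)"
      using scale[of "inverse c" "c *\<^sub>R x"] that by simp
    then show "c * q x \<le> q (c *\<^sub>R x)"
      using that by (simp add: field_simps)
  qed (rule scale[OF that])
  then have "q (c *\<^sub>R x) = c * q x" if "0 \<le> c" for c x
    using that zero by (cases "c = 0") auto
  then show ?thesis
    using add by (auto simp: sublinear_def)
qed

text \<open>
  Infima of functionals are formed here in three situations: over a chain of sublinear functionals,
  over the translates in \<open>sublinear_lower_at\<close> and over the distances to the points of a subspace.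
  The individual \<open>g i\<close> need not be sublinear in the last two, so the closure conditions allow the
  index to change.
\<close>

lemma sublinear_INF:
  fixes g :: "'i \<Rightarrow> 'a::real_vector \<Rightarrow> real"
  assumes ne: "I \<noteq> {}"
    and lower: "\<And>i x. i \<in> I \<Longrightarrow> l x \<le> g i x"
    and add: "\<And>i j x y. i \<in> I \<Longrightarrow> j \<in> I \<Longrightarrow> \<exists>k\<in>I. g k (x + y) \<le> g i x + g j y"
    and scale: "\<And>i c x. i \<in> I \<Longrightarrow> 0 < c \<Longrightarrow> \<exists>k\<in>I. g k (c *\<^sub>R x) \<le> c * g i x"
  shows "sublinear (\<lambda>x. INF i\<in>I. g i x)"
proof -
  have INF_le: "(INF i\<in>I. g i x) \<le> g k x" if "k \<in> I" for k x
    by (rule cINF_lower[OF _ that]) (use lower in \<open>auto intro!: bdd_belowI2\<close>)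
  show ?thesis
  proof (rule sublinearI)
    fix x y
    have "(INF i\<in>I. g i (x + y)) - g i x \<le> (INF j\<in>I. g j y)" if i: "i \<in> I" for i
    proof (rule cINF_greatest[OF ne])
      fix j assume "j \<in> I"
      with add[OF i] obtain k where "k \<in> I" "g k (x + y) \<le> g i x + g j y"
        by blast
      with INF_le[of k "x + y"] show "(INF i\<in>I. g i (x + y)) - g i x \<le> g j y"
        by simp
    qed
    then have "(INF i\<in>I. g i (x + y)) - (INF j\<in>I. g j y) \<le> (INF i\<in>I. g i x)"
      by (intro cINF_greatest[OF ne]) (auto simp: algebra_simps)
    then show "(INF i\<in>I. g i (x + y)) \<le> (INF i\<in>I. g i x) + (INF i\<in>I. g i y)"
      by simp
  next
    fix c :: real and x
    assume c: "0 < c"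
    have "(INF i\<in>I. g i (c *\<^sub>R x)) / c \<le> (INF i\<in>I. g i x)"
    proof (rule cINF_greatest[OF ne])
      fix i assume "i \<in> I"
      with scale[OF this c] obtain k where "k \<in> I" "g k (c *\<^sub>R x) \<le> c * g i x"
        by blast
      with INF_le[of k "c *\<^sub>R x"] have "(INF i\<in>I. g i (c *\<^sub>R x)) \<le> c * g i x"
        by simp
      with c show "(INF i\<in>I. g i (c *\<^sub>R x)) / c \<le> g i x"
        by (simp add: field_simps)
    qed
    with c show "(INF i\<in>I. g i (c *\<^sub>R x)) \<le> c * (INF i\<in>I. g i x)"
      by (simp add: field_simps)
  qed
qed

lemma sublinear_infdist:
  fixes Y :: "'a::real_normed_vector set"
  assumes "subspace Y"
  shows "sublinear (\<lambda>x. infdist x Y)"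
proof -
  have ne: "Y \<noteq> {}"
    using assms subspace_0 by blast
  have "sublinear (\<lambda>x. INF a\<in>Y. dist x a)"
  proof (rule sublinear_INF[OF ne, where l = "\<lambda>_. 0"])
    fix a b x y assume "a \<in> Y" "b \<in> Y"
    then have "a + b \<in> Y" "dist (x + y) (a + b) \<le> dist x a + dist y b"
      using assms by (auto simp: subspace_add dist_triangle_add)
    then show "\<exists>k\<in>Y. dist (x + y) k \<le> dist x a + dist y b"
      by blast
  next
    fix a x and c :: real assume "a \<in> Y" "0 < c"
    then have "c *\<^sub>R a \<in> Y" "dist (c *\<^sub>R x) (c *\<^sub>R a) \<le> c * dist x a"
      using assms by (auto simp: subspace_scale dist_norm simp flip: scaleR_diff_right)
    then show "\<exists>k\<in>Y. dist (c *\<^sub>R x) k \<le> c * dist x a"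
      by blast
  qed auto
  then show ?thesis
    using ne by (simp add: infdist_def)
qed

lemma infdist_minus_subspace:
  fixes Y :: "'a::real_normed_vector set"
  assumes "subspace Y"
  shows "infdist (- x) Y = infdist x Y"
proof -
  have "uminus ` Y = Y"
    using assms by (force simp: subspace_neg intro: rev_image_eqI[of "- y" for y])
  then have "(\<lambda>a. dist (- x) a) ` Y = (\<lambda>a. dist (- x) (- a)) ` Y"
    by (metis image_image)
  then show ?thesis
    by (simp add: infdist_def dist_minus)
qed

text \<open>
  This is the step that turns minimality into linearity: \<open>r\<close> is a smaller sublinear functional
  which is at most \<open>- q z\<close> at \<open>- z\<close>, the value that a linear functional equal to \<open>q\<close> at \<open>z\<close> has.
  The witness is \<open>r x = inf {q (x + t z) - t q z | t \<ge> 0}\<close>; the choices \<open>t = 0\<close> and \<open>t = 1\<close> give the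
  two bounds.
\<close>

lemma sublinear_lower_at:
  fixes q :: "'a::real_vector \<Rightarrow> real"
  assumes q: "sublinear q"
  obtains r where "sublinear r" "\<And>x. r x \<le> q x" "r (- z) \<le> - q z"
proof
  define g where "g t x = q (x + t *\<^sub>R z) - t * q z" for t x
  define r where "r x = (INF t\<in>{0..}. g t x)" for x
  have lower: "- q (- x) \<le> g t x" if "t \<in> {0..}" for t x
    using sublinear_add[OF q, of "- x" "x + t *\<^sub>R z"] sublinear_scaleR[OF q, of t z] that
    by (simp add: g_def)
  have r_le: "r x \<le> g t x" if "t \<in> {0..}" for t x
    unfolding r_def
    by (rule cINF_lower[OF _ that]) (use lower in \<open>auto intro!: bdd_belowI2\<close>)
  have "sublinear (\<lambda>x. INF t\<in>{0..}. g t x)"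
  proof (rule sublinear_INF[where l = "\<lambda>x. - q (- x)"])
    fix s t :: real and x y assume "s \<in> {0..}" "t \<in> {0..}"
    moreover have "g (s + t) (x + y) \<le> g s x + g t y"
      using sublinear_add[OF q, of "x + s *\<^sub>R z" "y + t *\<^sub>R z"]
      by (simp add: g_def algebra_simps)
    ultimately show "\<exists>k\<in>{0..}. g k (x + y) \<le> g s x + g t y"
      by (intro bexI[of _ "s + t"]) auto
  next
    fix t c :: real and x assume t: "t \<in> {0..}" and c: "0 < c"
    moreover have "g (c * t) (c *\<^sub>R x) \<le> c * g t x"
      using sublinear_scaleR[OF q, of c "x + t *\<^sub>R z"] c
      by (simp add: g_def algebra_simps)
    ultimately show "\<exists>k\<in>{0..}. g k (c *\<^sub>R x) \<le> c * g t x"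
      by (intro bexI[of _ "c * t"]) auto
  qed (use lower in auto)
  then show "sublinear r"
    by (simp add: r_def[abs_def])
  show "r x \<le> q x" for x
    using r_le[of 0 x] by (simp add: g_def)
  show "r (- z) \<le> - q z"
    using r_le[of 1 "- z"] sublinear_zero[OF q] by (simp add: g_def)
qed

text \<open>
  Zorn's lemma for the reversed pointwise order. The pointwise infimum of a nonempty chain exists
  because every sublinear \<open>q \<le> p\<close> satisfies \<open>q x \<ge> - q (- x) \<ge> - p (- x)\<close>.
\<close>

lemma minimal_sublinear_exists:
  fixes p :: "'a::real_vector \<Rightarrow> real"
  assumes p: "sublinear p"
  obtains m where "sublinear m" "m \<le> p" "\<And>r. sublinear r \<Longrightarrow> r \<le> m \<Longrightarrow> r = m"
proof -
  let ?A = "{q. sublinear q \<and> q \<le> p}"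
  let ?P = "\<lambda>q r :: 'a \<Rightarrow> real. r \<le> q"
  have "\<exists>m\<in>?A. \<forall>r\<in>?A. r \<le> m \<longrightarrow> r = m"
  proof (rule predicate_Zorn)
    show "partial_order_on ?A (relation_of ?P ?A)"
      by (rule partial_order_on_relation_ofI) auto
    fix C assume C: "C \<in> Chains (relation_of ?P ?A)"
    then have sub: "C \<subseteq> ?A" and tot: "\<And>q r. q \<in> C \<Longrightarrow> r \<in> C \<Longrightarrow> q \<le> r \<or> r \<le> q"
      by (auto simp: Chains_def relation_of_def)
    show "\<exists>u\<in>?A. \<forall>q\<in>C. u \<le> q"
    proof (cases "C = {}")
      case True
      with p show ?thesis by auto
    next
      case False
      have lower: "- p (- x) \<le> q x" if "q \<in> C" for q x
      proof -
        have "sublinear q" "q (- x) \<le> p (- x)"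
          using sub that by (auto simp: le_fun_def)
        with sublinear_minus[of q x] show ?thesis
          by simp
      qed
      let ?u = "\<lambda>x. INF q\<in>C. q x"
      have u_le: "?u \<le> q" if "q \<in> C" for q
      proof (rule le_funI)
        show "?u x \<le> q x" for x
          by (rule cINF_lower[OF _ that]) (use lower in \<open>auto intro!: bdd_belowI2\<close>)
      qed
      have "sublinear ?u"
      proof (rule sublinear_INF[OF False, where l = "\<lambda>x. - p (- x)"])
        fix q r x y assume qr: "q \<in> C" "r \<in> C"
        \<comment> \<open>The smaller of the two members of the chain bounds both values.\<close>
        then obtain k where k: "k \<in> C" "k \<le> q" "k \<le> r"
          using tot[OF qr] by blast
        have "k (x + y) \<le> k x + k y"
          using k sub sublinear_add by blast
        also have "\<dots> \<le> q x + r y"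
          using k by (intro add_mono) (auto simp: le_fun_def)
        finally show "\<exists>k\<in>C. k (x + y) \<le> q x + r y"
          using k by blast
      next
        fix q x and c :: real assume "q \<in> C" "0 < c"
        then have "q (c *\<^sub>R x) = c * q x"
          using sub by (intro sublinear_scaleR) auto
        with \<open>q \<in> C\<close> show "\<exists>k\<in>C. k (c *\<^sub>R x) \<le> c * q x"
          by (intro bexI[of _ q]) simp_all
      qed (use lower in auto)
      moreover obtain q where "q \<in> C"
        using False by blast
      then have "?u \<le> p"
        using u_le sub by (blast intro: order_trans)
      ultimately show ?thesis
        using u_le by (intro bexI[of _ ?u]) auto
    qed
  qed
  then obtain m where "m \<in> ?A" and min: "\<And>r. r \<in> ?A \<Longrightarrow> r \<le> m \<Longrightarrow> r = m"
    by blast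
  then show ?thesis
    using that[of m] order_trans by blast
qed

lemma minimal_sublinear_imp_linear:
  fixes m :: "'a::real_vector \<Rightarrow> real"
  assumes m: "sublinear m" and min: "\<And>r. sublinear r \<Longrightarrow> r \<le> m \<Longrightarrow> r = m"
  shows "linear m"
proof -
  have neg: "m (- z) = - m z" for z
  proof -
    obtain r where r: "sublinear r" "\<And>x. r x \<le> m x" "r (- z) \<le> - m z"
      by (rule sublinear_lower_at[OF m, of z]) blast
    then have "r = m"
      by (intro min) (auto simp: le_fun_def)
    with r sublinear_minus[OF m, of z] show ?thesis
      by simp
  qed
  show ?thesis
  proof (rule linearI)
    fix x y
    show "m (x + y) = m x + m y"
      using sublinear_add[OF m, of x y] sublinear_add[OF m, of "- x" "- y"] neg[of "x + y"]
      by (simp add: neg)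
  next
    fix c :: real and x
    show "m (c *\<^sub>R x) = c *\<^sub>R m x"
    proof (cases "0 \<le> c")
      case True
      then show ?thesis by (simp add: sublinear_scaleR[OF m])
    next
      case False
      then have "m ((- c) *\<^sub>R x) = - c * m x"
        by (intro sublinear_scaleR[OF m]) auto
      with neg[of "c *\<^sub>R x"] show ?thesis by simp
    qed
  qed
qed

text \<open>
  Before passing to a minimal functional, \<open>p\<close> is lowered at \<open>- z\<close>; any linear functional below
  the result is then forced to attain \<open>p z\<close> at \<open>z\<close>.
\<close>

lemma Hahn_Banach_support:
  fixes p :: "'a::real_vector \<Rightarrow> real"
  assumes p: "sublinear p"
  obtains f where "linear f" "\<And>x. f x \<le> p x" "f z = p z"
proof -
  obtain r where r: "sublinear r" "\<And>x. r x \<le> p x" "r (- z) \<le> - p z"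
    by (rule sublinear_lower_at[OF p, of z]) blast
  obtain f where f: "sublinear f" "f \<le> r" "\<And>q. sublinear q \<Longrightarrow> q \<le> f \<Longrightarrow> q = f"
    by (rule minimal_sublinear_exists[OF r(1)]) blast
  have lin: "linear f"
    by (rule minimal_sublinear_imp_linear[OF f(1)]) (rule f(3))
  have le: "f x \<le> p x" for x
    using f(2) r(2) by (meson le_funD order_trans)
  have "f (- z) \<le> - p z"
    using f(2) r(3) by (meson le_funD order_trans)
  then have "f z = p z"
    using le[of z] linear_neg[OF lin, of z] by simp
  with lin le that show ?thesis
    by blast
qed

section \<open>The dual unit ball in the weak-star topology\<close>

text \<open>
  The functionals are kept as elements of the full function space, whose topology is the product
  topology. The weak-star topology on the ball is therefore the subspace topology
  \<open>top_of_set dual_ball\<close>.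
\<close>

definition dual_ball :: "('a::real_normed_vector \<Rightarrow> real) set"
  where "dual_ball = {f. linear f \<and> (\<forall>x. \<bar>f x\<bar> \<le> norm x)}"

text \<open>
  The distance to \<open>Y\<close> is sublinear, vanishes exactly on \<open>Y\<close> and is bounded by the norm, so a linear
  functional supporting it at \<open>z\<close> has all the required properties.
\<close>

lemma Hahn_Banach_separation:
  fixes Y :: "'a::real_normed_vector set"
  assumes Y: "closed Y" "subspace Y" and z: "z \<notin> Y"
  obtains f where "f \<in> dual_ball" "\<And>y. y \<in> Y \<Longrightarrow> f y = 0" "f z \<noteq> 0"
proof -
  obtain f where f: "linear f" "\<And>x. f x \<le> infdist x Y" "f z = infdist z Y"
    by (rule Hahn_Banach_support[OF sublinear_infdist[OF Y(2)], of z]) blast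
  have abs: "\<bar>f x\<bar> \<le> infdist x Y" for x
    using f(2)[of x] f(2)[of "- x"] linear_neg[OF f(1), of x] infdist_minus_subspace[OF Y(2), of x]
    by simp
  show ?thesis
  proof (rule that[of f])
    have "infdist x Y \<le> norm x" for x
      using infdist_le[OF subspace_0[OF Y(2)], of x] by simp
    then show "f \<in> dual_ball"
      using f(1) abs order_trans unfolding dual_ball_def by blast
    show "f y = 0" if "y \<in> Y" for y
      using abs[of y] that by simp
    have "Y \<noteq> {}" using Y subspace_0 by blast
    with Y z have "infdist z Y \<noteq> 0"
      by (simp add: in_closed_iff_infdist_zero)
    with f show "f z \<noteq> 0" by simp
  qed
qed

text \<open>
  The Banach--Alaoglu theorem: linearity and the norm bound are closed conditions on coordinates,
  and the norm bound places the ball inside a product of compact intervals, which is compact by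
  Tychonoff's theorem.
\<close>

lemma compact_space_dual_ball:
  "compact_space (top_of_set (dual_ball :: ('a::real_normed_vector \<Rightarrow> real) set))"
proof -
  let ?P = "PiE UNIV (\<lambda>x :: 'a. cball (0::real) (norm x))"
  have "compactin (product_topology (\<lambda>x::'a. euclidean :: real topology) UNIV) ?P"
    by (subst compactin_PiE) auto
  then have comp: "compactin euclidean ?P"
    by (simp add: euclidean_product_topology)
  have eq: "dual_ball =
    (\<Inter>x. \<Inter>y. {f. f (x + y) = f x + f y}) \<inter> (\<Inter>c. \<Inter>x. {f. f (c *\<^sub>R x) = c * f x}) \<inter>
    (\<Inter>x. {f :: 'a \<Rightarrow> real. \<bar>f x\<bar> \<le> norm x})"
    by (auto simp: dual_ball_def linear_iff)
  have "closed (dual_ball :: ('a \<Rightarrow> real) set)"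
    unfolding eq
    by (intro closed_Int closed_INT ballI closed_Collect_eq closed_Collect_le continuous_intros
        continuous_on_product_coordinates)
  moreover have "dual_ball \<subseteq> ?P"
    by (auto simp: dual_ball_def)
  ultimately have "compactin euclidean (dual_ball :: ('a \<Rightarrow> real) set)"
    using comp by (meson closed_compactin closed_closedin)
  then show ?thesis
    by (simp add: compact_space_subtopology)
qed

text \<open>
  The set \<open>Q\<close> consists of the linear combinations with rational coefficients, encoded by lists so
  that countability is immediate; its closure absorbs real scalars because the rationals are dense.
\<close>

lemma countable_superset_closure_subspace:
  fixes D :: "'a::real_normed_vector set"
  assumes "countable D"
  obtains Q where "countable Q" "D \<subseteq> Q" "subspace (closure Q)"
proof -
  define \<phi> :: "(rat \<times> 'a) list \<Rightarrow> 'a"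
    where "\<phi> = (\<lambda>l. sum_list (map (\<lambda>(r, d). of_rat r *\<^sub>R d) l))"
  define Q where "Q = \<phi> ` lists (UNIV \<times> D)"
  have Q_add: "a + b \<in> Q" if ab: "a \<in> Q" "b \<in> Q" for a b
  proof -
    obtain k l where "k \<in> lists (UNIV \<times> D)" "l \<in> lists (UNIV \<times> D)" "a = \<phi> k" "b = \<phi> l"
      using ab by (auto simp: Q_def)
    then have "k @ l \<in> lists (UNIV \<times> D)" "a + b = \<phi> (k @ l)"
      by (auto simp: \<phi>_def)
    then show ?thesis
      unfolding Q_def by blast
  qed
  have Q_scale: "of_rat s *\<^sub>R a \<in> Q" if a: "a \<in> Q" for a s
  proof -
    obtain l where l: "l \<in> lists (UNIV \<times> D)" "a = \<phi> l"
      using a by (auto simp: Q_def)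
    have "of_rat s *\<^sub>R \<phi> l = \<phi> (map (\<lambda>(r, d). (s * r, d)) l)"
      by (induction l) (auto simp: \<phi>_def scaleR_add_right of_rat_mult)
    moreover have "map (\<lambda>(r, d). (s * r, d)) l \<in> lists (UNIV \<times> D)"
      using l by auto
    ultimately show ?thesis
      using l unfolding Q_def by blast
  qed
  have "countable Q"
    unfolding Q_def using assms by (intro countable_image countable_lists) auto
  moreover have "D \<subseteq> Q"
  proof
    fix d assume "d \<in> D"
    then have "\<phi> [(1, d)] \<in> Q"
      unfolding Q_def by (intro imageI) simp
    then show "d \<in> Q"
      by (simp add: \<phi>_def)
  qed
  moreover have "subspace (closure Q)"
    unfolding subspace_def
  proof (intro conjI ballI allI)
    have "\<phi> [] \<in> Q" unfolding Q_def by blast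
    then show "0 \<in> closure Q"
      using closure_subset by (auto simp: \<phi>_def)
    fix x y assume "x \<in> closure Q" "y \<in> closure Q"
    then obtain u v where "\<And>n. u n \<in> Q" "u \<longlonglongrightarrow> x" "\<And>n. v n \<in> Q" "v \<longlonglongrightarrow> y"
      unfolding closure_sequential by blast
    then show "x + y \<in> closure Q"
      unfolding closure_sequential
      by (intro exI[of _ "\<lambda>n. u n + v n"]) (auto intro: Q_add tendsto_add)
  next
    fix c :: real and x assume "x \<in> closure Q"
    then obtain u where u: "\<And>n. u n \<in> Q" "u \<longlonglongrightarrow> x"
      unfolding closure_sequential by blast
    have "c \<in> closure \<rat>"
    proof (unfold closure_approachable, intro allI impI)
      fix e :: real assume "0 < e"
      then obtain r where "r \<in> \<rat>" "c < r" "r < c + e"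
        using Rats_dense_in_real[of c "c + e"] by auto
      then show "\<exists>r\<in>\<rat>. dist r c < e"
        by (intro bexI[of _ r]) (auto simp: dist_real_def)
    qed
    then obtain s where s: "\<And>n. s n \<in> \<rat>" "s \<longlonglongrightarrow> c"
      unfolding closure_sequential by blast
    have "s n *\<^sub>R u n \<in> Q" for n
      using s(1)[of n] Q_scale[OF u(1)] by (auto elim!: Rats_cases)
    moreover have "(\<lambda>n. s n *\<^sub>R u n) \<longlonglongrightarrow> c *\<^sub>R x"
      by (intro tendsto_scaleR s u)
    ultimately show "c *\<^sub>R x \<in> closure Q"
      unfolding closure_sequential by (intro exI[of _ "\<lambda>n. s n *\<^sub>R u n"]) auto
  qed
  ultimately show ?thesis
    by (rule that)
qed

text \<open>
  A neighbourhood of \<open>0\<close> in the product topology restricts only finitely many coordinates, so it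
  contains every functional of the ball vanishing at those. Collecting the coordinates over a
  countable neighbourhood base gives a countable set on which no functional but \<open>0\<close> vanishes.
\<close>

lemma first_countable_dual_ball_imp_separable:
  assumes "first_countable (top_of_set (dual_ball :: ('a::real_normed_vector \<Rightarrow> real) set))"
  shows "separable_space (euclidean :: 'a topology)"
proof -
  let ?K = "top_of_set (dual_ball :: ('a \<Rightarrow> real) set)"
  let ?z = "(\<lambda>_. 0) :: 'a \<Rightarrow> real"
  have z: "?z \<in> dual_ball"
    by (auto simp: dual_ball_def linear_iff)
  then obtain \<B> where \<B>: "countable \<B>" "\<And>V. V \<in> \<B> \<Longrightarrow> openin ?K V"
    "\<And>U. openin ?K U \<Longrightarrow> ?z \<in> U \<Longrightarrow> \<exists>V\<in>\<B>. ?z \<in> V \<and> V \<subseteq> U"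
    using assms unfolding first_countable_def by fastforce
  have "\<exists>F. finite F \<and> (\<forall>f\<in>dual_ball. (\<forall>x\<in>F. f x = 0) \<longrightarrow> f \<in> V)"
    if V: "openin ?K V" "?z \<in> V" for V
  proof -
    obtain W where W: "open W" "V = dual_ball \<inter> W"
      using V by (auto simp: openin_open)
    then have "openin (product_topology (\<lambda>_ :: 'a. euclidean :: real topology) UNIV) W" "?z \<in> W"
      using V by (auto simp: open_fun_def)
    from product_topology_open_contains_basis[OF this] obtain X
      where X: "?z \<in> PiE UNIV X" "finite {i. X i \<noteq> UNIV}" "PiE UNIV X \<subseteq> W"
      by auto
    have "f \<in> PiE UNIV X" if "\<forall>x\<in>{i. X i \<noteq> UNIV}. f x = 0" for f
      using that X(1) by (auto simp: PiE_iff) (metis UNIV_I)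
    with X W show ?thesis
      by (intro exI[of _ "{i. X i \<noteq> UNIV}"]) blast
  qed
  then obtain F where F: "\<And>V. openin ?K V \<Longrightarrow> ?z \<in> V \<Longrightarrow> finite (F V)"
    "\<And>V f. openin ?K V \<Longrightarrow> ?z \<in> V \<Longrightarrow> f \<in> dual_ball \<Longrightarrow> (\<forall>x\<in>F V. f x = 0) \<Longrightarrow> f \<in> V"
    by metis
  define D where "D = (\<Union>V\<in>{V\<in>\<B>. ?z \<in> V}. F V)"
  have "countable D"
    unfolding D_def using \<B>(1,2) F(1)
    by (intro countable_UN) (auto intro: countable_finite)
  then obtain Q where Q: "countable Q" "D \<subseteq> Q" "subspace (closure Q)"
    by (rule countable_superset_closure_subspace)
  have "closure Q = UNIV"
  proof (rule ccontr)
    assume "closure Q \<noteq> UNIV"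
    then obtain x where "x \<notin> closure Q"
      by blast
    then obtain f where f: "f \<in> dual_ball" "\<And>y. y \<in> closure Q \<Longrightarrow> f y = 0" "f x \<noteq> 0"
      using Hahn_Banach_separation[OF closed_closure Q(3)] by metis
    \<comment> \<open>A neighbourhood of \<open>0\<close> that excludes \<open>f\<close>, although \<open>f\<close> vanishes on \<open>D\<close>.\<close>
    have "open {g :: 'a \<Rightarrow> real. g x \<noteq> f x}"
      by (intro open_Collect_neq continuous_on_product_coordinates continuous_on_const)
    then have "openin ?K (dual_ball \<inter> {g. g x \<noteq> f x})"
      by (rule openin_open_Int)
    moreover have "?z \<in> dual_ball \<inter> {g. g x \<noteq> f x}"
      using z f by auto
    ultimately obtain V where V: "V \<in> \<B>" "?z \<in> V" "V \<subseteq> dual_ball \<inter> {g. g x \<noteq> f x}"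
      using \<B>(3) by meson
    have "\<forall>y\<in>F V. f y = 0"
      using V Q(2) f(2) closure_subset by (auto simp: D_def)
    then have "f \<in> V"
      using F(2) V \<B>(2) f(1) by blast
    with V show False by blast
  qed
  with Q(1) show ?thesis
    unfolding separable_space_def by auto
qed

section \<open>Hyperplanes and the size of covering families\<close>

lemma is_hyperplane_kernel:
  fixes h :: "'a::real_normed_vector \<Rightarrow> real"
  assumes h: "bounded_linear h" and z: "h z \<noteq> 0"
  shows "is_hyperplane {x. h x = 0}"
  unfolding is_hyperplane_def
proof (intro conjI exI)
  interpret bounded_linear h by (rule h)
  show "closed {x. h x = 0}"
    by (intro closed_Collect_eq continuous_on_const linear_continuous_on h)
  show "subspace {x. h x = 0}"
    by (auto simp: subspace_def add scaleR)
  show "z \<notin> {x. h x = 0}" using z by simp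
  show "span (insert z {x. h x = 0}) = UNIV"
  proof (intro equalityI subsetI)
    fix x
    let ?c = "h x / h z"
    have "x - ?c *\<^sub>R z \<in> span (insert z {x. h x = 0})"
      using z by (intro span_base) (simp add: diff scaleR)
    moreover have "?c *\<^sub>R z \<in> span (insert z {x. h x = 0})"
      by (intro span_scale span_base) auto
    ultimately show "x \<in> span (insert z {x. h x = 0})"
      using span_add by fastforce
  qed simp
qed

text \<open>
  A subspace containing a ball contains a positive multiple of every vector.
\<close>

lemma interior_hyperplane_empty:
  fixes H :: "'a::real_normed_vector set"
  assumes "is_hyperplane H"
  shows "interior H = {}"
proof (rule ccontr)
  assume "interior H \<noteq> {}"
  then obtain x e where e: "0 < e" "cball x e \<subseteq> H"
    using mem_interior_cball by blast
  have H: "subspace H" and "H \<noteq> UNIV"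
    using assms by (auto simp: is_hyperplane_def)
  have "y \<in> H" for y
  proof (cases "y = 0")
    case True
    then show ?thesis using H subspace_0 by blast
  next
    case False
    let ?c = "e / norm y"
    \<comment> \<open>Moving from the centre by \<open>?c *\<^sub>R y\<close> ends on the boundary sphere of the ball.\<close>
    have "x \<in> H" "x + ?c *\<^sub>R y \<in> H"
      using e False by (auto intro!: subsetD[OF e(2)] simp: dist_norm)
    then have "(x + ?c *\<^sub>R y) - x \<in> H"
      using H subspace_diff by blast
    then have "?c *\<^sub>R y \<in> H"
      by simp
    then have "inverse ?c *\<^sub>R ?c *\<^sub>R y \<in> H"
      by (rule subspace_scale[OF H])
    with e False show ?thesis by simp
  qed
  with \<open>H \<noteq> UNIV\<close> show False by blast
qed

lemma countable_hyperplanes_not_cover: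
  fixes \<H> :: "'a::banach set set"
  assumes "countable \<H>" "\<And>H. H \<in> \<H> \<Longrightarrow> is_hyperplane H"
  shows "\<Union>\<H> \<noteq> UNIV"
proof -
  have "completely_metrizable_space (euclidean :: 'a topology)"
    by (rule completely_metrizable_space_euclidean)
  then have "euclidean interior_of \<Union>\<H> = {}"
    using assms interior_hyperplane_empty
    by (intro Baire_category_alt) (auto simp: is_hyperplane_def)
  then show ?thesis by auto
qed

lemma uncountable_iff_omega_1_ordLeq:
  "uncountable A \<longleftrightarrow> omega_1 \<le>o |A|"
  using cardSuc_ordLess_ordLeq[OF natLeq_Card_order card_of_Card_order, of A]
  by (simp add: countable_card_le_natLeq natLeq_Well_order card_of_Well_order
      not_ordLeq_iff_ordLess)

lemma uncountable_subset_omega_1: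
  assumes "uncountable A"
  obtains B where "B \<subseteq> A" "|B| =o omega_1"
proof -
  have "Card_order omega_1"
    by (simp add: cardSuc_Card_order natLeq_Card_order)
  then have F: "|Field omega_1| =o omega_1"
    by (rule card_of_Field_ordIso)
  then have "|Field omega_1| \<le>o |A|"
    using assms uncountable_iff_omega_1_ordLeq ordIso_ordLeq_trans by blast
  then obtain B where "B \<subseteq> A" "|Field omega_1| =o |B|"
    using internalize_card_of_ordLeq2 by metis
  with F that show ?thesis
    using ordIso_symmetric ordIso_transitive by blast
qed

text \<open>
  Countably many members of \<open>H_sigma\<close> involve only countably many hyperplanes altogether.
\<close>

lemma uncountable_covers_by_H_sigma:
  fixes \<F> :: "'a::banach set set"
  assumes "covers_by_H_sigma \<F>"
  shows "uncountable \<F>"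
proof
  assume "countable \<F>"
  have "\<forall>A\<in>\<F>. \<exists>\<H>. countable \<H> \<and> (\<forall>H\<in>\<H>. is_hyperplane H) \<and> A \<subseteq> \<Union>\<H>"
    using assms by (auto simp: covers_by_H_sigma_def H_sigma_def)
  then obtain \<H> where \<H>: "\<And>A. A \<in> \<F> \<Longrightarrow> countable (\<H> A)"
    "\<And>A H. A \<in> \<F> \<Longrightarrow> H \<in> \<H> A \<Longrightarrow> is_hyperplane H" "\<And>A. A \<in> \<F> \<Longrightarrow> A \<subseteq> \<Union>(\<H> A)"
    by metis
  have "countable (\<Union>A\<in>\<F>. \<H> A)"
    using \<open>countable \<F>\<close> \<H>(1) by (intro countable_UN)
  then have "\<Union>(\<Union>A\<in>\<F>. \<H> A) \<noteq> UNIV"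
    by (rule countable_hyperplanes_not_cover) (use \<H>(2) in blast)
  moreover have "\<Union>\<F> \<subseteq> \<Union>(\<Union>A\<in>\<F>. \<H> A)"
    using \<H>(3) by fastforce
  ultimately show False
    using assms unfolding covers_by_H_sigma_def by auto
qed

text \<open>
  The value \<open>cov\<close> is meaningful only once some covering family is known to exist: then
  well-ordering of cardinals provides one of least cardinality.
\<close>

lemma cov_eq_omega_1I:
  fixes \<G> :: "'a::banach set set"
  assumes \<G>: "covers_by_H_sigma \<G>" "|\<G>| \<le>o omega_1"
  shows "cov TYPE('a) =o omega_1"
proof -
  let ?min = "\<lambda>\<F> :: 'a set set. covers_by_H_sigma \<F> \<and>
       (\<forall>\<G> :: 'a set set. covers_by_H_sigma \<G> \<longrightarrow> |\<F>| \<le>o |\<G>| )"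
  let ?R = "card_of ` (Collect covers_by_H_sigma :: 'a set set set)"
  have "\<exists>r\<in>?R. \<forall>r'\<in>?R. r \<le>o r'"
    by (rule exists_minim_Card_order) (use \<G>(1) card_of_Card_order in auto)
  then have "\<exists>\<F>. ?min \<F>"
    by auto
  then have F: "?min (SOME \<F>. ?min \<F>)"
    by (rule someI_ex)
  then have "cov TYPE('a) \<le>o omega_1"
    unfolding cov_def using \<G> ordLeq_transitive by blast
  moreover have "omega_1 \<le>o cov TYPE('a)"
    unfolding cov_def using F uncountable_covers_by_H_sigma uncountable_iff_omega_1_ordLeq by blast
  ultimately show ?thesis
    using ordIso_iff_ordLeq by blast
qed

section \<open>Pairs of functionals accumulating at the diagonal\<close>

text \<open>
  If uncountably many pairs in \<open>A\<close> differed at \<open>x\<close>, uncountably many would differ there by at least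
  a fixed positive amount. The latter is a closed condition, so it would persist in the closure and
  keep the closure away from the diagonal.
\<close>

lemma countable_separated_pairs:
  fixes S :: "('i \<Rightarrow> real) set"
  assumes A: "A \<subseteq> S \<times> S"
    and clus: "\<And>B. B \<subseteq> A \<Longrightarrow> uncountable B \<Longrightarrow>
      prod_topology (top_of_set S) (top_of_set S) closure_of B \<inter> diagonal (top_of_set S) \<noteq> {}"
  shows "countable {(f, g) \<in> A. f x \<noteq> g x}"
proof -
  let ?K = "top_of_set S"
  let ?B = "\<lambda>n :: nat. {(f, g) \<in> A. 1 / real (Suc n) \<le> \<bar>f x - g x\<bar>}"
  have "countable (?B n)" for n
  proof (rule ccontr)
    assume "uncountable (?B n)"
    then have meets: "prod_topology ?K ?K closure_of (?B n) \<inter> diagonal ?K \<noteq> {}"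
      by (intro clus) auto
    let ?C = "{p \<in> topspace (prod_topology ?K ?K). \<bar>fst p x - snd p x\<bar> \<in> {1 / real (Suc n)..}}"
    have coord: "continuous_map ?K euclideanreal (\<lambda>f. f x)"
      unfolding continuous_map_iff_continuous
      by (rule continuous_on_subset[OF continuous_on_product_coordinates subset_UNIV])
    have "continuous_map (prod_topology ?K ?K) euclideanreal (\<lambda>p. fst p x)"
      using continuous_map_compose[OF continuous_map_fst coord, of ?K] unfolding o_def .
    moreover have "continuous_map (prod_topology ?K ?K) euclideanreal (\<lambda>p. snd p x)"
      using continuous_map_compose[OF continuous_map_snd coord, of ?K] unfolding o_def .
    ultimately have "continuous_map (prod_topology ?K ?K) euclideanreal (\<lambda>p. \<bar>fst p x - snd p x\<bar>)"
      by (intro continuous_map_real_abs continuous_map_diff)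
    then have "closedin (prod_topology ?K ?K) ?C"
      by (rule closedin_continuous_map_preimage) auto
    moreover have "?B n \<subseteq> ?C"
      using A by auto
    ultimately have "prod_topology ?K ?K closure_of (?B n) \<subseteq> ?C"
      by (rule closure_of_minimal[rotated])
    moreover have "?C \<inter> diagonal ?K = {}"
      by (auto simp: diagonal_def)
    ultimately show False
      using meets by blast
  qed
  then have "countable (\<Union>n. ?B n)"
    by simp
  moreover have "{(f, g) \<in> A. f x \<noteq> g x} \<subseteq> (\<Union>n. ?B n)"
  proof clarsimp
    fix f g assume "(f, g) \<in> A" "f x \<noteq> g x"
    then have "0 < \<bar>f x - g x\<bar>" by simp
    from nat_approx_posE[OF this] show "\<exists>n. 1 / (1 + real n) \<le> \<bar>f x - g x\<bar>"
      by (metis less_eq_real_def of_nat_Suc)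
  qed
  ultimately show ?thesis
    by (rule countable_subset[rotated])
qed

lemma is_hyperplane_equalizer_dual_ball:
  assumes "f \<in> dual_ball" "g \<in> dual_ball" "f \<noteq> g"
  shows "is_hyperplane {x. f x = g x}"
proof -
  have "bounded_linear (\<lambda>x. f x - g x)"
    using assms unfolding dual_ball_def
    by (intro bounded_linear_sub bounded_linear_intro[where K = 1])
      (auto simp: linear_add linear_scale)
  moreover obtain z where "f z - g z \<noteq> 0"
    using assms(3) by (auto simp: fun_eq_iff)
  ultimately show ?thesis
    using is_hyperplane_kernel[of "\<lambda>x. f x - g x" z] by simp
qed

theorem theorem4:
  assumes "\<And>K :: ('a::banach \<Rightarrow> real) topology.
      compact_space K \<Longrightarrow> Hausdorff_space K \<Longrightarrow> has_small_diagonal K \<Longrightarrow> metrizable_space K"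
    and "\<not> separable_space (euclidean :: 'a::banach topology)"
  shows "cov TYPE('a::banach) =o omega_1"
proof -
  let ?K = "top_of_set (dual_ball :: ('a \<Rightarrow> real) set)"
  have "\<not> metrizable_space ?K"
    using assms(2) first_countable_dual_ball_imp_separable metrizable_imp_first_countable by blast
  moreover have "Hausdorff_space ?K"
    by (intro Hausdorff_space_subtopology)
      (simp add: Hausdorff_space_product_topology flip: euclidean_product_topology)
  ultimately have "\<not> has_small_diagonal ?K"
    using assms(1) compact_space_dual_ball by blast
  then obtain A\<^sub>0 where A\<^sub>0: "A\<^sub>0 \<subseteq> dual_ball \<times> dual_ball - diagonal ?K" "uncountable A\<^sub>0"
    and clus: "\<And>B. B \<subseteq> A\<^sub>0 \<Longrightarrow> uncountable B \<Longrightarrow>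
      prod_topology ?K ?K closure_of B \<inter> diagonal ?K \<noteq> {}"
    unfolding has_small_diagonal_def topspace_euclidean_subtopology by meson
  \<comment> \<open>Accumulation at the diagonal is inherited by uncountable subsets, so passing to one of size
    \<open>omega_1\<close> costs nothing and bounds the size of the cover.\<close>
  obtain A where A: "A \<subseteq> A\<^sub>0" "|A| =o omega_1"
    using uncountable_subset_omega_1[OF A\<^sub>0(2)] by blast
  have unc: "uncountable A"
    using A(2) ordIso_symmetric ordIso_imp_ordLeq uncountable_iff_omega_1_ordLeq by blast
  define \<G> where "\<G> = (\<lambda>(f, g). {x :: 'a. f x = g x}) ` A"
  have hyp: "is_hyperplane H" if "H \<in> \<G>" for H
  proof -
    obtain p where p: "p \<in> A" "H = (case p of (f, g) \<Rightarrow> {x. f x = g x})"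
      using \<open>H \<in> \<G>\<close> unfolding \<G>_def by (rule imageE)
    then obtain f g where "(f, g) \<in> A" "H = {x. f x = g x}"
      by (cases p) simp
    moreover from this have "f \<in> dual_ball" "g \<in> dual_ball" "f \<noteq> g"
      using A A\<^sub>0 by (auto simp: diagonal_def)
    ultimately show ?thesis
      using is_hyperplane_equalizer_dual_ball by blast
  qed
  have "x \<in> \<Union>\<G>" for x
  proof -
    have "countable {(f, g) \<in> A. f x \<noteq> g x}"
      using A A\<^sub>0 clus by (intro countable_separated_pairs[of A dual_ball]) auto
    with unc have "\<not> A \<subseteq> {(f, g) \<in> A. f x \<noteq> g x}"
      using countable_subset by blast
    then obtain f g where "(f, g) \<in> A" "f x = g x"
      by blast
    then show ?thesis
      unfolding \<G>_def by (intro UnionI[of "{x. f x = g x}"] rev_image_eqI[of "(f, g)"]) simp_all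
  qed
  moreover have "\<G> \<subseteq> H_sigma"
  proof
    fix H assume "H \<in> \<G>"
    with hyp have "countable {H} \<and> (\<forall>H'\<in>{H}. is_hyperplane H') \<and> H \<subseteq> \<Union>{H}"
      by simp
    then show "H \<in> H_sigma"
      unfolding H_sigma_def by blast
  qed
  ultimately have "covers_by_H_sigma \<G>"
    by (auto simp: covers_by_H_sigma_def)
  moreover have "|\<G>| \<le>o omega_1"
    unfolding \<G>_def using card_of_image A(2) ordLeq_ordIso_trans by blast
  ultimately show ?thesis
    by (rule cov_eq_omega_1I)
qed

end
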